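(* Let $N\in\mathbb{N}$ and let $f,g:\mathbb{N}\to\mathbb{C}$ be arbitrary arithmetic functions. For $a\in\mathbb{N}$ put $$C_{f,g}(N,a)=\sum_{n\le N} f(n)\,g(n+a),\qquad C_{f,g_N}(N,a)=\sum_{n\le N} f(n)\,g_N(n+a),$$ where $g_N(m)=\sum_{d\mid m,\ d\le N} g'(d)$. Let $\|f\|_\infty=\max_{n\le N}|f(n)|$ and $\|g'\|_\infty=\max_{N<d\le N+a}|g'(d)|$. Then, uniformly for all $a\in\mathbb{N}$, $$C_{f,g}(N,a)=C_{f,g_N}(N,a)+O\big(\|f\|_\infty\,\|g'\|_\infty\, a\big).$$ Furthermore, if $f$ and $g$ both satisfy the Ramanujan Conjecture, then, again uniformly for all $a\in\mathbb{N}$, $$C_{f,g}(N,a)=C_{f,g_N}(N,a)+O_\varepsilon\big(N^\varepsilon (N+a)^\varepsilon a\big)\quad\text{for every }\varepsilon>0.$$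
   Context: For $h:\mathbb{N}\to\mathbb{C}$, its Eratosthenes Transform is $h'=h*\mu$, i.e. $h'(d)=\sum_{t\mid d} h(t)\mu(d/t)$, where $\mu$ is the Möbius function (so $\sum_{d\mid n}h'(d)=h(n)$). An arithmetic function $h$ satisfies the Ramanujan Conjecture if for every $\varepsilon>0$ there is $C(\varepsilon)>0$ with $|h(n)|\le C(\varepsilon)n^\varepsilon$ for all $n\in\mathbb{N}$. The notation $X=O(Y)$ means $|X|\le CY$ with an absolute constant $C$; $O_\varepsilon$ means the constant may depend on $\varepsilon$. *)

theory Defs
  imports Complex_Main "HOL-Computational_Algebra.Squarefree"
begin

(* Arithmetic functions live on the positive integers. They are rendered as functions on
   the type nat whose value at 0 is irrelevant: no definition below uses h 0 as long as
   the indices it is applied to are positive. *)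

definition moebius_mu :: "nat \<Rightarrow> complex" where
  "moebius_mu n = (if squarefree n then (- 1) ^ card (prime_factors n) else 0)"

definition eratosthenes_transform :: "(nat \<Rightarrow> complex) \<Rightarrow> nat \<Rightarrow> complex" where
  "eratosthenes_transform h d = (\<Sum>t | t dvd d. h t * moebius_mu (d div t))"

definition ramanujan_conjecture :: "(nat \<Rightarrow> complex) \<Rightarrow> bool" where
  "ramanujan_conjecture h \<longleftrightarrow>
     (\<forall>\<epsilon>>0. \<exists>C>0. \<forall>n>0. norm (h n) \<le> C * real n powr \<epsilon>)"

(* The truncation usually written with the subscript N: the divisor sum over d <= N. *)
definition truncated :: "(nat \<Rightarrow> complex) \<Rightarrow> nat \<Rightarrow> nat \<Rightarrow> complex" where
  "truncated g N m = (\<Sum>d | d dvd m \<and> d \<le> N. eratosthenes_transform g d)"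

definition correlation :: "(nat \<Rightarrow> complex) \<Rightarrow> (nat \<Rightarrow> complex) \<Rightarrow> nat \<Rightarrow> nat \<Rightarrow> complex" where
  "correlation f g N a = (\<Sum>n=1..N. f n * g (n + a))"

(* Maximum of the modulus over a finite index set, which has to be nonempty for Max to
   be meaningful. *)
definition max_norm_on :: "nat set \<Rightarrow> (nat \<Rightarrow> complex) \<Rightarrow> real" where
  "max_norm_on A h = Max ((\<lambda>n. norm (h n)) ` A)"

end

theory Submission
  imports Defs
begin

text \<open>
  Moebius inversion turns the difference of the two correlations into
  $\sum_{n \le N} f(n) \sum_{d \mid n+a, d > N} g'(d)$. Only $N < d \le N + a$ occur, and since
  $d > N$ each such $d$ divides $n + a$ for at most one $n \le N$; so at most $a$ terms survive
  after exchanging the sums. The second estimate follows because $g'$ inherits the Ramanujan bound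
  from $g$ by the divisor bound $\tau(n) = O(n^\varepsilon)$.
\<close>

section \<open>Moebius inversion\<close>

text \<open>A prime coprime to k leaves squarefreeness unchanged and adds exactly one prime factor,
  which flips the sign. This is the cancellation used in the next sum.\<close>

lemma moebius_mu_prime_mult:
  assumes "prime p" "\<not> p dvd k" "k > 0"
  shows "moebius_mu (p * k) = - moebius_mu k"
proof -
  have cop: "coprime p k"
    using assms by (simp add: prime_imp_coprime)
  have sq: "squarefree (p * k) \<longleftrightarrow> squarefree k"
    using cop assms(1) squarefree_mult_coprime[of p k] squarefree_prime[of p]
      squarefree_multD(2)[of p k] by auto
  have "prime_factors (p * k) = insert p (prime_factors k)"
    using assms by (subst prime_factors_product) (auto simp: prime_factorization_prime)
  moreover have "p \<notin> prime_factors k"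
    using assms(2) by auto
  ultimately show ?thesis
    by (simp add: moebius_mu_def sq)
qed

text \<open>For m > 1, fix a prime p dividing m. Among the squarefree divisors, those prime to p are
  paired with those divisible by p via k and p * k, and each pair cancels.\<close>

lemma sum_moebius_mu_divisors:
  assumes "m > 0"
  shows "(\<Sum>k | k dvd m. moebius_mu k) = (if m = 1 then 1 else 0)"
proof (cases "m = 1")
  case True
  then show ?thesis by (simp add: moebius_mu_def)
next
  case False
  then obtain p where p: "prime p" "p dvd m"
    using prime_factor_nat by blast
  let ?D = "{k. k dvd m \<and> squarefree k}"
  have fin: "finite ?D" using assms by simp
  have split: "?D = {k\<in>?D. \<not> p dvd k} \<union> {k\<in>?D. p dvd k}" by auto
  have bij: "bij_betw (\<lambda>k. p * k) {k\<in>?D. \<not> p dvd k} {k\<in>?D. p dvd k}"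
  proof (rule bij_betw_imageI)
    show "inj_on (\<lambda>k. p * k) {k\<in>?D. \<not> p dvd k}"
      using p by (auto simp: inj_on_def)
    show "(\<lambda>k. p * k) ` {k\<in>?D. \<not> p dvd k} = {k\<in>?D. p dvd k}"
    proof (intro equalityI subsetI)
      fix x assume "x \<in> (\<lambda>k. p * k) ` {k\<in>?D. \<not> p dvd k}"
      then obtain k where k: "x = p * k" "k dvd m" "squarefree k" "\<not> p dvd k" by auto
      have cop: "coprime p k" using p k by (simp add: prime_imp_coprime)
      then have "p * k dvd m" using p k by (simp add: divides_mult)
      moreover have "squarefree (p * k)"
        using cop k p by (simp add: squarefree_mult_coprime squarefree_prime)
      ultimately show "x \<in> {k\<in>?D. p dvd k}" using k by simp
    next
      fix x assume x: "x \<in> {k\<in>?D. p dvd k}"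
      then obtain k where k: "x = p * k" by auto
      have "\<not> p dvd k"
      proof
        assume "p dvd k"
        then have "p ^ 2 dvd x" using k by (simp add: power2_eq_square)
        with x have "p dvd 1" by (auto simp: squarefree_def)
        with p show False by simp
      qed
      moreover have "k dvd m" using x k by (auto dest: dvd_mult_right)
      moreover have "squarefree k" using x k by (auto dest: squarefree_multD)
      ultimately show "x \<in> (\<lambda>k. p * k) ` {k\<in>?D. \<not> p dvd k}" using k by auto
    qed
  qed
  have "(\<Sum>k | k dvd m. moebius_mu k) = (\<Sum>k\<in>?D. moebius_mu k)"
    using assms by (intro sum.mono_neutral_right) (auto simp: moebius_mu_def)
  also have "\<dots> = (\<Sum>k\<in>{k\<in>?D. \<not> p dvd k}. moebius_mu k) + (\<Sum>k\<in>{k\<in>?D. p dvd k}. moebius_mu k)"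
    by (subst split, intro sum.union_disjoint finite_subset[OF _ fin]) auto
  also have "(\<Sum>k\<in>{k\<in>?D. p dvd k}. moebius_mu k) = (\<Sum>k\<in>{k\<in>?D. \<not> p dvd k}. moebius_mu (p * k))"
    using sum.reindex_bij_betw[OF bij, of moebius_mu] by simp
  also have "\<dots> = (\<Sum>k\<in>{k\<in>?D. \<not> p dvd k}. - moebius_mu k)"
    using p by (intro sum.cong refl moebius_mu_prime_mult) (auto intro!: Nat.gr0I)
  finally show ?thesis using False by (simp add: sum_negf)
qed

text \<open>After exchanging the sums, the coefficient of \<open>g t\<close> is the sum of
  \<open>moebius_mu\<close> over the divisors of n / t, which vanishes unless t = n.\<close>

lemma sum_eratosthenes_transform_divisors:
  assumes "n > 0"
  shows "(\<Sum>d | d dvd n. eratosthenes_transform g d) = g n"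
proof -
  have fin: "finite {d. d dvd n}" using assms by simp
  \<comment> \<open>That t divides n follows from t dividing d and d dividing n; writing it out
    gives t a fixed finite range, as the exchange of sums requires.\<close>
  have "(\<Sum>d | d dvd n. eratosthenes_transform g d)
      = (\<Sum>d\<in>{d. d dvd n}. \<Sum>t | t \<in> {t. t dvd n} \<and> t dvd d. g t * moebius_mu (d div t))"
    unfolding eratosthenes_transform_def
    by (intro sum.cong refl) (auto intro: dvd_trans)
  also have "\<dots> = (\<Sum>t\<in>{t. t dvd n}. \<Sum>d | d \<in> {d. d dvd n} \<and> t dvd d. g t * moebius_mu (d div t))"
    by (rule sum.swap_restrict[OF fin fin])
  also have "\<dots> = (\<Sum>t\<in>{t. t dvd n}. if t = n then g t else 0)"
  proof (rule sum.cong[OF refl])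
    fix t assume t: "t \<in> {t. t dvd n}"
    then obtain k where k: "n = t * k" by auto
    have pos: "t > 0" "k > 0" using k assms by auto
    have "(\<Sum>d | d \<in> {d. d dvd n} \<and> t dvd d. g t * moebius_mu (d div t))
        = (\<Sum>j | j dvd k. g t * moebius_mu j)"
      \<comment> \<open>Substitution d = t * j, where j runs over the divisors of k = n / t.\<close>
      by (rule sum.reindex_bij_witness[of _ "\<lambda>j. t * j" "\<lambda>d. d div t"])
        (use pos k in auto)
    also have "\<dots> = g t * (if k = 1 then 1 else 0)"
      using sum_moebius_mu_divisors[OF pos(2)] by (simp add: sum_distrib_left[symmetric])
    also have "\<dots> = (if t = n then g t else 0)" using k pos by auto
    finally show "(\<Sum>d | d \<in> {d. d dvd n} \<and> t dvd d. g t * moebius_mu (d div t))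
        = (if t = n then g t else 0)" .
  qed
  also have "\<dots> = g n" using fin by (simp add: sum.delta)
  finally show ?thesis .
qed

section \<open>The truncation error of the correlation\<close>

lemma diff_truncated:
  assumes "m > 0"
  shows "g m - truncated g N m = (\<Sum>d | d dvd m \<and> N < d. eratosthenes_transform g d)"
proof -
  have "{d. d dvd m} = {d. d dvd m \<and> d \<le> N} \<union> {d. d dvd m \<and> N < d}" by auto
  then have "g m = (\<Sum>d\<in>{d. d dvd m \<and> d \<le> N} \<union> {d. d dvd m \<and> N < d}. eratosthenes_transform g d)"
    using sum_eratosthenes_transform_divisors[OF assms, of g] by metis
  also have "\<dots> = truncated g N m + (\<Sum>d | d dvd m \<and> N < d. eratosthenes_transform g d)"
    unfolding truncated_def using assms by (intro sum.union_disjoint) auto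
  finally show ?thesis by simp
qed

text \<open>F and G are arbitrary upper bounds rather than the maxima, so that both the maxima and
  the Ramanujan bounds can be inserted later.\<close>

lemma correlation_truncation_bound:
  assumes a: "a > 0" and N: "N > 0"
    and F: "\<And>n. n \<in> {1..N} \<Longrightarrow> norm (f n) \<le> F"
    and G: "\<And>d. d \<in> {N<..N+a} \<Longrightarrow> norm (eratosthenes_transform g d) \<le> G"
  shows "norm (correlation f g N a - correlation f (truncated g N) N a) \<le> F * G * real a"
proof -
  let ?h = "eratosthenes_transform g"
  \<comment> \<open>Both ranges contain a point, n = 1 and d = N + 1, and there the bound dominates
    a norm.\<close>
  have F0: "F \<ge> 0" using order_trans[OF norm_ge_zero F[of 1]] N by simp
  have G0: "G \<ge> 0" using order_trans[OF norm_ge_zero G[of "N + 1"]] a by simp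
  have "correlation f g N a - correlation f (truncated g N) N a
      = (\<Sum>n=1..N. f n * (g (n + a) - truncated g N (n + a)))"
    by (simp add: correlation_def sum_subtractf right_diff_distrib)
  also have "\<dots> = (\<Sum>n=1..N. \<Sum>d | d \<in> {N<..N+a} \<and> d dvd n + a. f n * ?h d)"
  proof (rule sum.cong[OF refl])
    fix n assume n: "n \<in> {1..N}"
    \<comment> \<open>A divisor of the positive number n + a is at most n + a, hence at most N +
      a.\<close>
    have "{d. d dvd n + a \<and> N < d} = {d. d \<in> {N<..N+a} \<and> d dvd n + a}"
      using n a by (auto dest: dvd_imp_le)
    then show "f n * (g (n + a) - truncated g N (n + a))
        = (\<Sum>d | d \<in> {N<..N+a} \<and> d dvd n + a. f n * ?h d)"
      using diff_truncated[of "n + a" g N] a by (simp add: sum_distrib_left)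
  qed
  also have "\<dots> = (\<Sum>d\<in>{N<..N+a}. \<Sum>n | n \<in> {1..N} \<and> d dvd n + a. f n * ?h d)"
    by (rule sum.swap_restrict) auto
  also have "norm \<dots> \<le> (\<Sum>d\<in>{N<..N+a}. F * G)"
  proof (rule sum_norm_le)
    fix d assume d: "d \<in> {N<..N+a}"
    let ?S = "{n. n \<in> {1..N} \<and> d dvd n + a}"
    \<comment> \<open>If n > n', then d divides the positive number n - n', which is below N,
      contradicting d > N. By symmetry any two elements of \<open>?S\<close> agree.\<close>
    have le: "n \<le> n'" if "n \<in> ?S" "n' \<in> ?S" for n n'
    proof (rule ccontr)
      assume "\<not> n \<le> n'"
      moreover have "d dvd (n + a) - (n' + a)" using that by (intro dvd_diff_nat) auto
      ultimately have "d \<le> n - n'" by (intro dvd_imp_le) auto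
      with that d show False by auto
    qed
    have card: "card ?S \<le> 1"
      using le by (subst card_le_Suc0_iff_eq[unfolded One_nat_def[symmetric]]) (auto intro: antisym)
    have "norm (\<Sum>n\<in>?S. f n * ?h d) \<le> (\<Sum>n\<in>?S. F * G)"
      by (rule sum_norm_le) (use F G[OF d] F0 in \<open>auto simp: norm_mult intro!: mult_mono\<close>)
    also have "\<dots> = real (card ?S) * (F * G)" by simp
    also have "\<dots> \<le> 1 * (F * G)" using card F0 G0 by (intro mult_right_mono) auto
    finally show "norm (\<Sum>n\<in>?S. f n * ?h d) \<le> F * G" by simp
  qed
  also have "\<dots> = F * G * real a" by simp
  finally show ?thesis .
qed

section \<open>The divisor bound\<close>

text \<open>Every divisor of m * n factors as a divisor of m times a divisor of n, so the
  multiplication map on pairs covers all of them.\<close>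

lemma card_divisors_mult_le:
  fixes m n :: nat
  assumes "m > 0" "n > 0"
  shows "card {d. d dvd m * n} \<le> card {d. d dvd m} * card {d. d dvd n}"
proof -
  have "{d. d dvd m * n} \<subseteq> (\<lambda>(x, y). x * y) ` ({d. d dvd m} \<times> {d. d dvd n})"
    by (auto dest!: division_decomp)
  then have "card {d. d dvd m * n} \<le> card ({d. d dvd m} \<times> {d. d dvd n})"
    using assms by (intro surj_card_le) auto
  then show ?thesis by (simp add: card_cartesian_product)
qed

lemma card_divisors_prime_power_le:
  fixes p :: nat
  assumes "prime p"
  shows "card {d. d dvd p ^ e} \<le> e + 1"
proof -
  have "{d. d dvd p ^ e} \<subseteq> (\<lambda>i. p ^ i) ` {..e}"
    using assms by (auto simp: divides_primepow_nat)
  then have "card {d. d dvd p ^ e} \<le> card {..e}" by (intro surj_card_le) auto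
  then show ?thesis by simp
qed

text \<open>
  A prime power $p^e$ exactly dividing $n$ contributes the factor $(e+1)/p^{e\varepsilon}$ to
  $\tau(n)/n^\varepsilon$. It is at most $1$ if $p^\varepsilon \ge 2$, and at most $K$ otherwise since
  $2^{e\varepsilon} \ge 1 + e \varepsilon \ln 2$.
\<close>

lemma card_divisors_le_power_card:
  assumes e: "\<epsilon> > 0" and K: "K = max 1 (1 / (\<epsilon> * ln 2))" and "n > 0"
  shows "real (card {d. d dvd n})
    \<le> K ^ card {p \<in> prime_factors n. real p powr \<epsilon> < 2} * real n powr \<epsilon>"
  using \<open>n > 0\<close>
proof (induction n rule: less_induct)
  case (less n)
  let ?S = "\<lambda>n. {p \<in> prime_factors n. real p powr \<epsilon> < 2}"
  have K1: "K \<ge> 1" using K by simp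
  show ?case
  proof (cases "n = 1")
    case True
    then show ?thesis by simp
  next
    case False
    then obtain p where p: "prime p" "p dvd n" using prime_factor_nat by blast
    \<comment> \<open>Splitting off the full power of p leaves a cofactor m < n in which p does not
      occur, so the induction hypothesis applies to m and p is new to its prime factors.\<close>
    obtain m where m: "n = p ^ multiplicity p n * m" "\<not> p dvd m"
      using multiplicity_decompose'[of n p] less.prems prime_gt_1_nat[OF p(1)] by auto
    define e where "e = multiplicity p n"
    have nm: "n = p ^ e * m" using m e_def by simp
    have m0: "m > 0" using nm less.prems by auto
    have e0: "e > 0" using m p e_def by (intro Nat.gr0I) auto
    have "m < n"
      using nm m0 one_less_power[OF prime_gt_1_nat[OF p(1)] e0] by simp
    then have IH: "real (card {d. d dvd m}) \<le> K ^ card (?S m) * real m powr \<epsilon>"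
      using less.IH m0 by blast
    have p0: "p > 0" using p(1) by (simp add: prime_gt_0_nat)
    have powe: "real (p ^ e) powr \<epsilon> = (real p powr \<epsilon>) ^ e"
      using p0 by (simp add: powr_realpow[symmetric] powr_powr mult.commute)
    have pf: "prime_factors n = insert p (prime_factors m)"
      using nm m0 p0 e0 p(1)
      by (simp add: prime_factors_product prime_factorization_prime_power)
    have pnotin: "p \<notin> prime_factors m" using m by auto
    \<comment> \<open>The cost of passing from m to n: the factor e + 1 is paid by p^(e \<epsilon>),
      with one extra K exactly when p is small and so enters \<open>?S n\<close>.\<close>
    have main: "real (e + 1) * K ^ card (?S m) \<le> K ^ card (?S n) * real (p ^ e) powr \<epsilon>"
    proof (cases "real p powr \<epsilon> < 2")
      case True
      then have "?S n = insert p (?S m)" using pf by auto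
      then have c: "card (?S n) = Suc (card (?S m))" using pnotin by simp
      \<comment> \<open>The two entries of the maximum defining K play separate roles: K >= 1 covers
        the summand 1, and K >= 1 / (\<epsilon> ln 2) covers the summand e.\<close>
      have "real e + 1 \<le> K * (1 + real e * (\<epsilon> * ln 2))"
      proof -
        have "1 / (\<epsilon> * ln 2) \<le> K" using K by simp
        then have "1 \<le> K * (\<epsilon> * ln 2)" using \<open>\<epsilon> > 0\<close> by (simp add: field_simps)
        then have "real e * 1 \<le> real e * (K * (\<epsilon> * ln 2))" by (intro mult_left_mono) auto
        with K1 show ?thesis by (simp add: algebra_simps)
      qed
      also have "1 + real e * (\<epsilon> * ln 2) \<le> exp (real e * (\<epsilon> * ln 2))"
        by (rule exp_ge_add_one_self)
      also have "\<dots> = (2 powr \<epsilon>) ^ e"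
        by (simp add: powr_def exp_of_nat_mult)
      also have "\<dots> \<le> (real p powr \<epsilon>) ^ e"
        using \<open>\<epsilon> > 0\<close> prime_ge_2_nat[OF p(1)] by (intro power_mono powr_mono2) auto
      finally have "real (e + 1) \<le> K * (real p powr \<epsilon>) ^ e" using K1 by simp
      then have "real (e + 1) * K ^ card (?S m) \<le> K * (real p powr \<epsilon>) ^ e * K ^ card (?S m)"
        using K1 by (intro mult_right_mono) auto
      then show ?thesis unfolding powe by (simp add: c mult_ac)
    next
      case False
      then have S: "?S n = ?S m" using pf by auto
      have "e + 1 \<le> 2 ^ e" using less_exp[of e] by linarith
      then have "real (e + 1) \<le> 2 ^ e" by (metis of_nat_le_iff of_nat_numeral of_nat_power)
      also have "\<dots> \<le> (real p powr \<epsilon>) ^ e" using False by (intro power_mono) auto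
      finally have "real (e + 1) * K ^ card (?S m) \<le> (real p powr \<epsilon>) ^ e * K ^ card (?S m)"
        using K1 by (intro mult_right_mono) auto
      then show ?thesis unfolding powe by (simp add: S mult_ac)
    qed
    have "card {d. d dvd n} \<le> (e + 1) * card {d. d dvd m}"
      using card_divisors_mult_le[of "p ^ e" m] card_divisors_prime_power_le[OF p(1), of e] m0 p0 nm
      by (metis mult_le_mono1 order_trans zero_less_power)
    then have "real (card {d. d dvd n}) \<le> real (e + 1) * real (card {d. d dvd m})"
      by (metis of_nat_le_iff of_nat_mult)
    also have "\<dots> \<le> real (e + 1) * (K ^ card (?S m) * real m powr \<epsilon>)"
      using IH by (intro mult_left_mono) auto
    also have "\<dots> \<le> K ^ card (?S n) * real (p ^ e) powr \<epsilon> * real m powr \<epsilon>"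
      using mult_right_mono[OF main, of "real m powr \<epsilon>"] by (simp only: mult.assoc) simp
    also have "\<dots> = K ^ card (?S n) * real n powr \<epsilon>"
      by (subst (3) nm) (simp add: powr_mult)
    finally show ?thesis .
  qed
qed

text \<open>Primes with p^\<epsilon> < 2 lie below 2^(1/\<epsilon>), so their number is bounded
  independently of n and the power of K becomes a constant.\<close>

lemma divisor_bound:
  assumes "\<epsilon> > 0"
  shows "\<exists>C>0. \<forall>n>0. real (card {d. d dvd n}) \<le> C * real n powr \<epsilon>"
proof -
  define K :: real where "K = max 1 (1 / (\<epsilon> * ln 2))"
  define T where "T = {..nat \<lceil>2 powr (1 / \<epsilon>)\<rceil>}"
  have K1: "K \<ge> 1" by (simp add: K_def)
  have "real (card {d. d dvd n}) \<le> K ^ card T * real n powr \<epsilon>" if "n > 0" for n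
  proof -
    have "{p \<in> prime_factors n. real p powr \<epsilon> < 2} \<subseteq> T"
    proof
      fix p assume p: "p \<in> {p \<in> prime_factors n. real p powr \<epsilon> < 2}"
      then have "p > 0" by (auto simp: prime_gt_0_nat in_prime_factors_iff)
      then have "real p = (real p powr \<epsilon>) powr (1 / \<epsilon>)"
        using assms by (simp add: powr_powr)
      also have "\<dots> \<le> 2 powr (1 / \<epsilon>)" using p assms by (intro powr_mono2) auto
      finally show "p \<in> T" by (simp add: T_def) linarith
    qed
    then have "card {p \<in> prime_factors n. real p powr \<epsilon> < 2} \<le> card T"
      by (intro card_mono) (auto simp: T_def)
    then have "K ^ card {p \<in> prime_factors n. real p powr \<epsilon> < 2} * real n powr \<epsilon>
        \<le> K ^ card T * real n powr \<epsilon>"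
      using K1 by (intro mult_right_mono power_increasing) auto
    with card_divisors_le_power_card[OF assms K_def that] show ?thesis by linarith
  qed
  moreover have "K ^ card T > 0" using K1 by simp
  ultimately show ?thesis by blast
qed

section \<open>The Ramanujan bound for the Eratosthenes transform\<close>

lemma norm_moebius_mu_le: "norm (moebius_mu n) \<le> 1"
  by (simp add: moebius_mu_def norm_power)

text \<open>The exponent is split in half: one half bounds each summand through g, the other bounds
  the number of summands through the divisor bound.\<close>

lemma ramanujan_conjecture_eratosthenes_transform:
  assumes "ramanujan_conjecture g"
  shows "ramanujan_conjecture (eratosthenes_transform g)"
  unfolding ramanujan_conjecture_def
proof (intro allI impI)
  fix \<epsilon> :: real assume "\<epsilon> > 0"
  then have half: "\<epsilon> / 2 > 0" by simp
  from half obtain A where A: "A > 0" "\<And>n. n > 0 \<Longrightarrow> norm (g n) \<le> A * real n powr (\<epsilon> / 2)"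
    using assms unfolding ramanujan_conjecture_def by blast
  from divisor_bound[OF half] obtain B where B: "B > 0"
    "\<And>n. n > 0 \<Longrightarrow> real (card {d. d dvd n}) \<le> B * real n powr (\<epsilon> / 2)" by blast
  have "norm (eratosthenes_transform g n) \<le> A * B * real n powr \<epsilon>" if n: "n > 0" for n
  proof -
    have "norm (eratosthenes_transform g n) \<le> (\<Sum>t | t dvd n. A * real n powr (\<epsilon> / 2))"
      unfolding eratosthenes_transform_def
    proof (rule sum_norm_le)
      fix t assume "t \<in> {t. t dvd n}"
      then have t: "t > 0" "t \<le> n" using n by (auto intro: dvd_imp_le Nat.gr0I)
      have "norm (g t * moebius_mu (n div t)) \<le> norm (g t) * 1"
        unfolding norm_mult by (intro mult_left_mono norm_moebius_mu_le) simp
      also have "\<dots> \<le> A * real t powr (\<epsilon> / 2)" using A(2)[OF t(1)] by simp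
      also have "\<dots> \<le> A * real n powr (\<epsilon> / 2)"
        using A(1) t half by (intro mult_left_mono powr_mono2) auto
      finally show "norm (g t * moebius_mu (n div t)) \<le> A * real n powr (\<epsilon> / 2)" .
    qed
    also have "\<dots> = real (card {d. d dvd n}) * (A * real n powr (\<epsilon> / 2))" by simp
    also have "\<dots> \<le> B * real n powr (\<epsilon> / 2) * (A * real n powr (\<epsilon> / 2))"
      using A(1) B(2)[OF n] by (intro mult_right_mono) auto
    also have "\<dots> = A * B * (real n powr (\<epsilon> / 2) * real n powr (\<epsilon> / 2))" by (simp add: mult_ac)
    also have "\<dots> = A * B * real n powr \<epsilon>" by (simp add: powr_add[symmetric])
    finally show ?thesis .
  qed
  with A(1) B(1) show "\<exists>C>0. \<forall>n>0. norm (eratosthenes_transform g n) \<le> C * real n powr \<epsilon>"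
    by (intro exI[of _ "A * B"]) simp
qed

theorem theorem2p1:
  shows
    "(\<exists>C>0. \<forall>(f :: nat \<Rightarrow> complex) (g :: nat \<Rightarrow> complex) (N :: nat) (a :: nat).
        N > 0 \<longrightarrow> a > 0 \<longrightarrow>
        norm (correlation f g N a - correlation f (truncated g N) N a)
          \<le> C * (max_norm_on {1..N} f
                  * max_norm_on {N<..N+a} (eratosthenes_transform g) * real a))
     \<and>
     (\<forall>(f :: nat \<Rightarrow> complex) (g :: nat \<Rightarrow> complex).
        ramanujan_conjecture f \<longrightarrow> ramanujan_conjecture g \<longrightarrow>
        (\<forall>\<epsilon>>0. \<exists>C>0. \<forall>(N :: nat) (a :: nat).
           N > 0 \<longrightarrow> a > 0 \<longrightarrow>
           norm (correlation f g N a - correlation f (truncated g N) N a)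
             \<le> C * (real N powr \<epsilon> * real (N + a) powr \<epsilon> * real a)))"
proof (intro conjI allI impI)
  \<comment> \<open>The maxima themselves serve as F and G, so the absolute constant can be
    1.\<close>
  have "norm (correlation f g N a - correlation f (truncated g N) N a)
      \<le> max_norm_on {1..N} f * max_norm_on {N<..N+a} (eratosthenes_transform g) * real a"
    if "N > 0" "a > 0" for f g N a
    using that by (intro correlation_truncation_bound) (auto simp: max_norm_on_def)
  then show "\<exists>C>0. \<forall>(f :: nat \<Rightarrow> complex) (g :: nat \<Rightarrow> complex) (N :: nat) (a :: nat).
        N > 0 \<longrightarrow> a > 0 \<longrightarrow>
        norm (correlation f g N a - correlation f (truncated g N) N a)
          \<le> C * (max_norm_on {1..N} f
                  * max_norm_on {N<..N+a} (eratosthenes_transform g) * real a)"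
    by (intro exI[of _ 1]) simp
next
  fix f g :: "nat \<Rightarrow> complex" and \<epsilon> :: real
  assume f: "ramanujan_conjecture f" and g: "ramanujan_conjecture g" and \<epsilon>: "\<epsilon> > 0"
  \<comment> \<open>A and B depend only on f, g and \<epsilon>, so the final constant A * B is
    uniform in N and a. Using the full \<epsilon> for both functions yields the two separate powers
    of N and N + a.\<close>
  obtain A where A: "A > 0" "\<And>n. n > 0 \<Longrightarrow> norm (f n) \<le> A * real n powr \<epsilon>"
    using f \<epsilon> unfolding ramanujan_conjecture_def by blast
  obtain B where B: "B > 0"
    "\<And>n. n > 0 \<Longrightarrow> norm (eratosthenes_transform g n) \<le> B * real n powr \<epsilon>"
    using ramanujan_conjecture_eratosthenes_transform[OF g] \<epsilon>
    unfolding ramanujan_conjecture_def by blast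
  have "norm (correlation f g N a - correlation f (truncated g N) N a)
      \<le> A * B * (real N powr \<epsilon> * real (N + a) powr \<epsilon> * real a)" if N: "N > 0" and a: "a > 0" for N a
  proof -
    \<comment> \<open>Monotonicity of x^\<epsilon> replaces n by N here and d by N + a below, giving
      bounds constant on each range.\<close>
    have "norm (f n) \<le> A * real N powr \<epsilon>" if "n \<in> {1..N}" for n
    proof -
      have "A * real n powr \<epsilon> \<le> A * real N powr \<epsilon>"
        using that A(1) \<epsilon> by (intro mult_left_mono powr_mono2) auto
      with A(2)[of n] that show ?thesis by auto
    qed
    moreover have "norm (eratosthenes_transform g d) \<le> B * real (N + a) powr \<epsilon>"
      if "d \<in> {N<..N+a}" for d
    proof -
      have "B * real d powr \<epsilon> \<le> B * real (N + a) powr \<epsilon>"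
        using that B(1) \<epsilon> by (intro mult_left_mono powr_mono2) auto
      with B(2)[of d] that show ?thesis by auto
    qed
    ultimately have "norm (correlation f g N a - correlation f (truncated g N) N a)
        \<le> (A * real N powr \<epsilon>) * (B * real (N + a) powr \<epsilon>) * real a"
      by (intro correlation_truncation_bound[OF a N])
    then show ?thesis by (simp only: mult_ac)
  qed
  with A(1) B(1) show "\<exists>C>0. \<forall>(N :: nat) (a :: nat). N > 0 \<longrightarrow> a > 0 \<longrightarrow>
           norm (correlation f g N a - correlation f (truncated g N) N a)
             \<le> C * (real N powr \<epsilon> * real (N + a) powr \<epsilon> * real a)"
    by (intro exI[of _ "A * B"]) simp
qed

end
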